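(* Let $d\ge 1$ and let $H$ be a $d$-regular graph that has BEL gadgets. Suppose there exists a vertex $v\in V(H)$ such that $N(v)$ is an independent set and $H-v-N(v)$ (the graph obtained from $H$ by deleting $v$ and all its neighbors) is connected. Then $s(H)=2d-1$.
   Context: All graphs are finite and simple; a copy of a graph means a (not necessarily induced) subgraph isomorphic to it. For graphs $F,H$, write $F\to H$ if every 2-coloring (red/blue) of the edges of $F$ contains a monochromatic copy of $H$, and $F\not\to H$ otherwise. $F$ is Ramsey $H$-minimal if $F\to H$ and no proper subgraph $F'$ of $F$ satisfies $F'\to H$; $\mathcal{M}(H)$ denotes the set of such graphs, and $s(H)=\min_{F\in\mathcal{M}(H)}\delta(F)$ with $\delta(F)$ the minimum degree. A graph $H$ has BEL gadgets if for every graph $G$ and every 2-coloring $\psi$ of the edges of $G$ without a monochromatic copy of $H$, there is a graph $F$ such that (1) $F\not\to H$, (2) $F$ contains $G$ as an induced subgraph, and (3) for every 2-coloring of the edges of $F$ without a monochromatic copy of $H$, its restriction to $G$ agrees with $\psi$ up to swapping the two colors. *)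

theory Defs
  imports Main
begin

record 'a sgraph =
  verts :: "'a set"
  edges :: "'a set set"

definition simple_graph :: "'a sgraph \<Rightarrow> bool" where
  "simple_graph G \<longleftrightarrow> finite (verts G) \<and>
     edges G \<subseteq> {{u, v} | u v. u \<in> verts G \<and> v \<in> verts G \<and> u \<noteq> v}"

definition subgraph :: "'a sgraph \<Rightarrow> 'a sgraph \<Rightarrow> bool" where
  "subgraph K G \<longleftrightarrow> simple_graph K \<and> simple_graph G \<and>
     verts K \<subseteq> verts G \<and> edges K \<subseteq> edges G"

definition induced :: "'a sgraph \<Rightarrow> 'a set \<Rightarrow> 'a sgraph" where
  "induced G S = \<lparr>verts = verts G \<inter> S, edges = {e \<in> edges G. e \<subseteq> S}\<rparr>"

definition induced_subgraph :: "'a sgraph \<Rightarrow> 'a sgraph \<Rightarrow> bool" where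
  "induced_subgraph K G \<longleftrightarrow> subgraph K G \<and> K = induced G (verts K)"

definition delete_verts :: "'a sgraph \<Rightarrow> 'a set \<Rightarrow> 'a sgraph" where
  "delete_verts G S = induced G (verts G - S)"

definition isomorphic :: "'a sgraph \<Rightarrow> 'b sgraph \<Rightarrow> bool" where
  "isomorphic G H \<longleftrightarrow>
     (\<exists>f. bij_betw f (verts G) (verts H) \<and> (\<lambda>e. f ` e) ` edges G = edges H)"

definition neighbors :: "'a sgraph \<Rightarrow> 'a \<Rightarrow> 'a set" where
  "neighbors G v = {u. {u, v} \<in> edges G}"

definition vdegree :: "'a sgraph \<Rightarrow> 'a \<Rightarrow> nat" where
  "vdegree G v = card (neighbors G v)"

definition min_degree :: "'a sgraph \<Rightarrow> nat" where
  "min_degree G = Min (vdegree G ` verts G)"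

definition regular_graph :: "nat \<Rightarrow> 'a sgraph \<Rightarrow> bool" where
  "regular_graph d G \<longleftrightarrow> (\<forall>v \<in> verts G. vdegree G v = d)"

definition independent_set :: "'a sgraph \<Rightarrow> 'a set \<Rightarrow> bool" where
  "independent_set G S \<longleftrightarrow> S \<subseteq> verts G \<and> (\<forall>u \<in> S. \<forall>v \<in> S. {u, v} \<notin> edges G)"

text \<open>The graph without vertices counts as connected.\<close>

definition connected_graph :: "'a sgraph \<Rightarrow> bool" where
  "connected_graph G \<longleftrightarrow>
     (\<forall>u \<in> verts G. \<forall>v \<in> verts G. (u, v) \<in> {(x, y). {x, y} \<in> edges G}\<^sup>*)"

text \<open>A 2-coloring of the edges of a graph is a function on all vertex sets, of which only
  the values on edges are ever used; the two colors are the truth values.\<close>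

type_synonym 'a coloring = "'a set \<Rightarrow> bool"

definition monochromatic :: "'a coloring \<Rightarrow> 'a sgraph \<Rightarrow> bool" where
  "monochromatic c K \<longleftrightarrow> (\<exists>b. \<forall>e \<in> edges K. c e = b)"

definition has_mono_copy :: "'a coloring \<Rightarrow> 'a sgraph \<Rightarrow> 'b sgraph \<Rightarrow> bool" where
  "has_mono_copy c F H \<longleftrightarrow> (\<exists>K. subgraph K F \<and> isomorphic K H \<and> monochromatic c K)"

definition arrows :: "'a sgraph \<Rightarrow> 'b sgraph \<Rightarrow> bool" where
  "arrows F H \<longleftrightarrow> (\<forall>c. has_mono_copy c F H)"

text \<open>Finite graphs are taken, up to isomorphism, on vertices of type \<^typ>\<open>nat\<close>.\<close>

definition ramsey_minimal_graphs :: "'b sgraph \<Rightarrow> nat sgraph set" where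
  "ramsey_minimal_graphs H =
     {F. simple_graph F \<and> arrows F H \<and>
         (\<forall>F'. subgraph F' F \<and> F' \<noteq> F \<longrightarrow> \<not> arrows F' H)}"

definition ramsey_s :: "'b sgraph \<Rightarrow> nat" where
  "ramsey_s H = Inf (min_degree ` ramsey_minimal_graphs H)"

definition has_BEL_gadgets :: "'b sgraph \<Rightarrow> bool" where
  "has_BEL_gadgets H \<longleftrightarrow>
     (\<forall>(G :: nat sgraph) (\<psi> :: nat coloring).
        simple_graph G \<and> \<not> has_mono_copy \<psi> G H \<longrightarrow>
        (\<exists>F :: nat sgraph. simple_graph F \<and>
           \<not> arrows F H \<and>
           induced_subgraph G F \<and>
           (\<forall>c. \<not> has_mono_copy c F H \<longrightarrow>
              (\<forall>e \<in> edges G. c e = \<psi> e) \<or> (\<forall>e \<in> edges G. c e = (\<not> \<psi> e)))))"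

end

theory Submission
  imports Defs
begin

text \<open>Lower bound: if a vertex \<open>w\<close> of a minimal \<open>F\<close> had degree at most \<open>2 d - 2\<close>, a good coloring of
  \<open>F - w\<close> would extend by giving at most \<open>d - 1\<close> of the edges at \<open>w\<close> each color, and \<open>w\<close> could then
  lie on no monochromatic \<open>d\<close>-regular graph.

  Upper bound: build a colored graph in which every \<open>d\<close>-subset \<open>S\<close> of \<open>2 d - 1\<close> independent vertices
  is, in each color, the image of \<open>N(v)\<close> under a copy of \<open>H - v\<close>. It has no monochromatic copy of
  \<open>H\<close>: by regularity and connectedness such a copy would contain each private part
  \<open>H - v - N(v)\<close> entirely or not at all, and one part leaves it too few vertices, two parts too
  many. A BEL gadget forces this coloring up to swapping colors; a new vertex joined to the
  \<open>2 d - 1\<close> vertices sends \<open>d\<close> edges of one color to some \<open>S\<close> and so completes a copy of \<open>H\<close>. Every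
  minimal subgraph of the result must contain the new vertex.\<close>

section \<open>Copies of a graph as injective maps\<close>

definition mono_embedding ::
  "'a coloring \<Rightarrow> bool \<Rightarrow> ('b \<Rightarrow> 'a) \<Rightarrow> 'b sgraph \<Rightarrow> 'a sgraph \<Rightarrow> bool" where
  "mono_embedding c b g H F \<longleftrightarrow>
     inj_on g (verts H) \<and> g ` verts H \<subseteq> verts F \<and>
     (\<forall>e \<in> edges H. g ` e \<in> edges F \<and> c (g ` e) = b)"

definition map_sgraph :: "('a \<Rightarrow> 'b) \<Rightarrow> 'a sgraph \<Rightarrow> 'b sgraph" where
  "map_sgraph f G = \<lparr>verts = f ` verts G, edges = (`) f ` edges G\<rparr>"

lemma simple_graph_edgeD:
  assumes "simple_graph G" "{u, v} \<in> edges G"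
  shows "u \<in> verts G" "v \<in> verts G" "u \<noteq> v"
  using assms by (auto simp: simple_graph_def doubleton_eq_iff dest!: subsetD)

lemma simple_graph_edgeE:
  assumes "simple_graph G" "e \<in> edges G"
  obtains u v where "e = {u, v}" "u \<in> verts G" "v \<in> verts G" "u \<noteq> v"
  using assms by (auto simp: simple_graph_def)

lemma simple_graph_edge_subset: "simple_graph G \<Longrightarrow> e \<in> edges G \<Longrightarrow> e \<subseteq> verts G"
  by (auto elim: simple_graph_edgeE)

lemma simple_graph_finite_edges: "simple_graph G \<Longrightarrow> finite (edges G)"
  by (rule finite_subset[of _ "Pow (verts G)"])
    (auto simp: simple_graph_def)

lemma simple_graph_neighbors:
  assumes "simple_graph G"
  shows "neighbors G v \<subseteq> verts G" "finite (neighbors G v)" "v \<notin> neighbors G v"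
proof -
  show "v \<notin> neighbors G v"
    using simple_graph_edgeD(3)[OF assms, of v v] by (auto simp: neighbors_def)
  show "neighbors G v \<subseteq> verts G"
    using simple_graph_edgeD(1)[OF assms] by (auto simp: neighbors_def)
  then show "finite (neighbors G v)"
    using assms finite_subset by (auto simp: simple_graph_def)
qed

lemma simple_graph_map:
  assumes "simple_graph G" "inj_on f (verts G)"
  shows "simple_graph (map_sgraph f G)"
  unfolding simple_graph_def
proof (intro conjI subsetI)
  show "finite (verts (map_sgraph f G))"
    using assms by (auto simp: simple_graph_def map_sgraph_def)
  fix e assume "e \<in> edges (map_sgraph f G)"
  then obtain e' where e': "e' \<in> edges G" "e = f ` e'"
    by (auto simp: map_sgraph_def)
  from assms(1) e'(1) obtain u v where "e' = {u, v}" "u \<in> verts G" "v \<in> verts G" "u \<noteq> v"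
    by (rule simple_graph_edgeE)
  then have "e = {f u, f v}" "f u \<noteq> f v"
    "f u \<in> verts (map_sgraph f G)" "f v \<in> verts (map_sgraph f G)"
    using e'(2) assms(2) by (auto simp: map_sgraph_def inj_on_eq_iff)
  then show "e \<in> {{u, v} |u v. u \<in> verts (map_sgraph f G) \<and> v \<in> verts (map_sgraph f G) \<and> u \<noteq> v}"
    by blast
qed

lemma isomorphic_map:
  assumes "simple_graph H" "inj_on g (verts H)"
  shows "isomorphic (map_sgraph g H) H"
proof -
  let ?h = "inv_into (verts H) g"
  have "?h ` g ` e = e" if "e \<in> edges H" for e
    using assms(2) simple_graph_edge_subset[OF assms(1) that] by (rule inv_into_image_cancel)
  then have "(`) ?h ` edges (map_sgraph g H) = edges H"
    by (simp add: map_sgraph_def image_image)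
  moreover have "bij_betw ?h (verts (map_sgraph g H)) (verts H)"
    using assms(2) by (simp add: map_sgraph_def bij_betw_inv_into inj_on_imp_bij_betw)
  ultimately show ?thesis
    unfolding isomorphic_def by blast
qed

text \<open>The inverse of an isomorphism from \<open>K\<close> to \<open>H\<close> is the
  embedding; conversely the image graph \<open>map_sgraph g H\<close> is the copy. Maps with an
  explicit color \<open>b\<close> allow single vertices of \<open>H\<close> to be followed and edges
  at their images to be counted.\<close>

lemma has_mono_copy_iff:
  assumes F: "simple_graph F" and H: "simple_graph H"
  shows "has_mono_copy c F H \<longleftrightarrow> (\<exists>b g. mono_embedding c b g H F)"
proof
  assume "has_mono_copy c F H"
  then obtain K f b where K: "subgraph K F" and f: "bij_betw f (verts K) (verts H)"
    "(\<lambda>e. f ` e) ` edges K = edges H" and b: "\<forall>e \<in> edges K. c e = b"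
    by (auto simp: has_mono_copy_def isomorphic_def monochromatic_def)
  let ?g = "inv_into (verts K) f"
  have gf: "?g ` f ` e = e" if "e \<in> edges K" for e
    using K f(1) simple_graph_edge_subset[OF _ that]
    by (metis subgraph_def bij_betw_imp_inj_on inv_into_image_cancel)
  have "?g ` e \<in> edges F \<and> c (?g ` e) = b" if "e \<in> edges H" for e
  proof -
    obtain e' where "e' \<in> edges K" "e = f ` e'" using \<open>e \<in> edges H\<close> f(2) by blast
    then show ?thesis using gf[of e'] K b by (auto simp: subgraph_def)
  qed
  moreover have "bij_betw ?g (verts H) (verts K)"
    using f(1) by (rule bij_betw_inv_into)
  ultimately have "mono_embedding c b ?g H F"
    using K by (auto simp: mono_embedding_def bij_betw_def subgraph_def)
  then show "\<exists>b g. mono_embedding c b g H F" by blast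
next
  assume "\<exists>b g. mono_embedding c b g H F"
  then obtain b g where g: "mono_embedding c b g H F" by blast
  then have inj: "inj_on g (verts H)" by (simp add: mono_embedding_def)
  have "subgraph (map_sgraph g H) F"
    using g F simple_graph_map[OF H inj] by (auto simp: subgraph_def mono_embedding_def map_sgraph_def)
  moreover have "monochromatic c (map_sgraph g H)"
    using g by (auto simp: monochromatic_def mono_embedding_def map_sgraph_def)
  ultimately show "has_mono_copy c F H"
    using isomorphic_map[OF H inj] unfolding has_mono_copy_def by blast
qed

text \<open>Injectivity turns the degree of \<open>x\<close> into that many edges of color
  \<open>b\<close> at \<open>g x\<close>. Both bounds rest on this count.\<close>

lemma mono_embedding_neighbors:
  assumes "mono_embedding c b g H F" "simple_graph H" "x \<in> verts H"
  shows "g ` neighbors H x \<subseteq> {u \<in> neighbors F (g x). c {u, g x} = b}"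
    "card (g ` neighbors H x) = vdegree H x"
proof -
  show "g ` neighbors H x \<subseteq> {u \<in> neighbors F (g x). c {u, g x} = b}"
    using assms(1) by (force simp: mono_embedding_def neighbors_def)
  show "card (g ` neighbors H x) = vdegree H x"
    using assms(1) simple_graph_neighbors(1)[OF assms(2), of x]
    unfolding mono_embedding_def vdegree_def by (meson card_image inj_on_subset)
qed

text \<open>Copies pull back along the inverse of \<open>f\<close>. This serves to move a colored
  graph to vertices of type \<open>nat\<close>, where the gadgets live.\<close>

lemma has_mono_copy_map:
  assumes G: "simple_graph G" and H: "simple_graph H" and inj: "inj_on f (verts G)"
    and c: "\<And>e. e \<in> edges G \<Longrightarrow> c (f ` e) = c' e"
    and copy: "has_mono_copy c (map_sgraph f G) H"
  shows "has_mono_copy c' G H"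
proof -
  let ?h = "inv_into (verts G) f"
  obtain b g where g: "mono_embedding c b g H (map_sgraph f G)"
    using copy has_mono_copy_iff[OF simple_graph_map[OF G inj] H] by blast
  then have gv: "inj_on g (verts H)" "g ` verts H \<subseteq> f ` verts G"
    and ge: "\<And>e. e \<in> edges H \<Longrightarrow> g ` e \<in> (`) f ` edges G \<and> c (g ` e) = b"
    by (auto simp: mono_embedding_def map_sgraph_def)
  have hf: "?h ` f ` e = e" if "e \<in> edges G" for e
    using inj simple_graph_edge_subset[OF G that] by (rule inv_into_image_cancel)
  have "mono_embedding c' b (?h \<circ> g) H G"
    unfolding mono_embedding_def
  proof (intro conjI ballI)
    show "inj_on (?h \<circ> g) (verts H)"
      using gv by (meson comp_inj_on inj_on_inv_into inj_on_subset)
    show "(?h \<circ> g) ` verts H \<subseteq> verts G"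
      using gv(2) by (auto intro!: inv_into_into)
    fix e assume "e \<in> edges H"
    with ge obtain e' where e': "e' \<in> edges G" "g ` e = f ` e'" "c (f ` e') = b"
      by (metis imageE)
    then have "(?h \<circ> g) ` e = e'"
      using hf by (metis image_comp)
    with e' c show "(?h \<circ> g) ` e \<in> edges G" "c' ((?h \<circ> g) ` e) = b"
      by auto
  qed
  then show ?thesis
    using has_mono_copy_iff[OF G H] by blast
qed

section \<open>Ramsey-minimal subgraphs\<close>

lemma subgraph_trans: "subgraph A B \<Longrightarrow> subgraph B C \<Longrightarrow> subgraph A C"
  by (auto simp: subgraph_def)

lemma arrows_subgraph: "subgraph F' F \<Longrightarrow> arrows F' H \<Longrightarrow> arrows F H"
  unfolding arrows_def has_mono_copy_def by (meson subgraph_trans)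

lemma delete_verts_simps:
  "verts (delete_verts G S) = verts G - S"
  "edges (delete_verts G S) = {e \<in> edges G. e \<subseteq> verts G - S}"
  by (auto simp: delete_verts_def induced_def)

lemma subgraph_delete_verts:
  assumes "simple_graph G" shows "subgraph (delete_verts G S) G"
  using assms unfolding subgraph_def simple_graph_def delete_verts_simps
  by (auto, blast)

lemma ex_ramsey_minimal_subgraph:
  assumes "simple_graph F" "arrows F H"
  shows "\<exists>F'. subgraph F' F \<and> F' \<in> ramsey_minimal_graphs H"
  using assms
\<comment> \<open>The measure counts vertices and edges, since a proper subgraph may lose only edges
  or only isolated vertices.\<close>
proof (induction "card (verts F) + card (edges F)" arbitrary: F rule: less_induct)
  case less
  show ?case
  proof (cases "F \<in> ramsey_minimal_graphs H")
    case True
    with less.prems show ?thesis by (auto simp: subgraph_def)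
  next
    case False
    then obtain F' where F': "subgraph F' F" "F' \<noteq> F" "arrows F' H"
      using less.prems by (auto simp: ramsey_minimal_graphs_def)
    have fin: "finite (verts F)" "finite (edges F)"
      using less.prems(1) simple_graph_finite_edges by (auto simp: simple_graph_def)
    have le: "card (verts F') \<le> card (verts F)" "card (edges F') \<le> card (edges F)"
      using F'(1) fin by (auto simp: subgraph_def intro: card_mono)
    have "card (verts F') + card (edges F') \<noteq> card (verts F) + card (edges F)"
    proof
      assume "card (verts F') + card (edges F') = card (verts F) + card (edges F)"
      with le have "card (verts F') = card (verts F)" "card (edges F') = card (edges F)"
        by linarith+
      then have "verts F' = verts F" "edges F' = edges F"
        using F'(1) fin by (auto simp: subgraph_def dest: card_subset_eq)
      with F'(2) show False by simp
    qed
    with le have "card (verts F') + card (edges F') < card (verts F) + card (edges F)"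
      by linarith
    moreover have "simple_graph F'" using F'(1) by (simp add: subgraph_def)
    ultimately show ?thesis
      using less.hyps F'(1,3) subgraph_trans by blast
  qed
qed

section \<open>The lower bound on degrees in minimal graphs\<close>

lemma ramsey_minimal_vdegree_ge:
  assumes H: "simple_graph H" and reg: "regular_graph d H"
    and F: "F \<in> ramsey_minimal_graphs H" and w: "w \<in> verts F"
  shows "vdegree F w \<ge> 2 * d - 1"
proof (rule ccontr)
  assume "\<not> ?thesis"
  then have small: "vdegree F w < 2 * d - 1" by simp
  have sF: "simple_graph F" and aF: "arrows F H"
    using F by (auto simp: ramsey_minimal_graphs_def)
  let ?D = "delete_verts F {w}" and ?N = "neighbors F w"
  have sub: "subgraph ?D F" by (rule subgraph_delete_verts[OF sF])
  then have sD: "simple_graph ?D" by (simp add: subgraph_def)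
  have "?D \<noteq> F" using w by (metis Diff_iff delete_verts_simps(1) singletonI)
  then obtain c where c: "\<not> has_mono_copy c ?D H"
    using F sub by (auto simp: ramsey_minimal_graphs_def arrows_def)
  have finN: "finite ?N" by (rule simple_graph_neighbors[OF sF])
  \<comment> \<open>\<open>A\<close> holds the ends of the edges at \<open>w\<close> that get color
    \<open>True\<close>. As \<open>w\<close> has at most \<open>2 d - 2\<close> neighbors, taking
    \<open>d - 1\<close> of them, or all if there are fewer, leaves at most \<open>d - 1\<close> for
    the other color.\<close>
  obtain A where A: "A \<subseteq> ?N" "card A = min (d - 1) (card ?N)"
    using obtain_subset_with_card_n[of "min (d - 1) (card ?N)" ?N] by auto
  have cardA: "card A < d" using A small by (auto simp: vdegree_def)
  have cardB: "card (?N - A) < d"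
    using A small finN by (auto simp: vdegree_def card_Diff_subset finite_subset)
  define c' where "c' e = (if w \<in> e then \<exists>u\<in>A. e = {u, w} else c e)" for e
  have c'w: "c' {u, w} \<longleftrightarrow> u \<in> A" for u
    using A(1) simple_graph_neighbors(3)[OF sF, of w] by (auto simp: c'_def doubleton_eq_iff)
  obtain b g where g: "mono_embedding c' b g H F"
    using aF has_mono_copy_iff[OF sF H] unfolding arrows_def by blast
  show False
  proof (cases "w \<in> g ` verts H")
    case True
    then obtain x where x: "x \<in> verts H" "g x = w" by auto
    have "d = card (g ` neighbors H x)"
      using mono_embedding_neighbors(2)[OF g H x(1)] reg x by (auto simp: regular_graph_def)
    also have "\<dots> \<le> card {u \<in> ?N. c' {u, w} = b}"
      using mono_embedding_neighbors(1)[OF g H x(1)] finN x by (intro card_mono) auto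
    also have "{u \<in> ?N. c' {u, w} = b} = (if b then A else ?N - A)"
      using A(1) by (auto simp: c'w)
    finally show False using cardA cardB by (auto split: if_splits)
  next
    case False
    have "mono_embedding c b g H ?D"
      unfolding mono_embedding_def
    proof (intro conjI ballI)
      show "inj_on g (verts H)" "g ` verts H \<subseteq> verts ?D"
        using g False by (auto simp: mono_embedding_def delete_verts_simps)
      fix e assume e: "e \<in> edges H"
      then have "w \<notin> g ` e" using False simple_graph_edge_subset[OF H e] by auto
      with g e show "g ` e \<in> edges ?D" "c (g ` e) = b"
        using simple_graph_edge_subset[OF sF, of "g ` e"]
        by (auto simp: mono_embedding_def delete_verts_simps c'_def)
    qed
    with c has_mono_copy_iff[OF sD H] show False by blast
  qed
qed

section \<open>The colored host graph\<close>

locale regular_pointed_graph =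
  fixes H :: "'a sgraph" and v :: 'a and d :: nat
  assumes d: "d \<ge> 1" and H: "simple_graph H" and reg: "regular_graph d H"
    and v: "v \<in> verts H" and indep: "independent_set H (neighbors H v)"
    and conn: "connected_graph (delete_verts H ({v} \<union> neighbors H v))"
begin

abbreviation "N \<equiv> neighbors H v"

definition "outer = verts H - ({v} \<union> N)"

text \<open>With \<open>2 d - 1\<close> points, every 2-coloring of them has \<open>d\<close> of one
  color. Both colors are provided for each \<open>S\<close> because neither that set nor its color
  is known in advance.\<close>

definition "slots = {S. S \<subseteq> {..<2 * d - 1} \<and> card S = d} \<times> (UNIV :: bool set)"

definition labelling :: "nat set \<Rightarrow> 'a \<Rightarrow> nat" where
  "labelling S = (SOME f. bij_betw f N S)"

text \<open>Private vertices carry the tag \<open>i\<close>, whereas \<open>N(v)\<close> lands on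
  points that different slots may share. The value at \<open>v\<close> is a dummy that is no vertex
  of the host, hence the later restrictions to \<open>verts H - {v}\<close> and to edges avoiding
  \<open>v\<close>.\<close>

definition place :: "nat set \<times> bool \<Rightarrow> 'a \<Rightarrow> nat + (nat set \<times> bool) \<times> 'a" where
  "place i x = (if x \<in> N then Inl (labelling (fst i) x) else Inr (i, x))"

text \<open>For every \<open>d\<close>-subset \<open>S\<close> of \<open>2 d - 1\<close> independent vertices and each of the two colors, the
  host graph has a private copy of \<open>H - v - N(v)\<close> in that color, attached to \<open>S\<close> in the same color
  as it is attached to \<open>N(v)\<close> in \<open>H\<close>.\<close>

definition host :: "(nat + (nat set \<times> bool) \<times> 'a) sgraph" where
  "host = \<lparr>verts = Inl ` {..<2 * d - 1} \<union> Inr ` (slots \<times> outer),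
           edges = {place i ` e | i e. i \<in> slots \<and> e \<in> edges H \<and> v \<notin> e}\<rparr>"

text \<open>The tag of a private endpoint supplies the color. This is unambiguous because both ends
  of a host edge come from one slot.\<close>

definition host_coloring :: "(nat + (nat set \<times> bool) \<times> 'a) coloring" where
  "host_coloring e \<longleftrightarrow> (\<exists>S x. Inr ((S, True), x) \<in> e)"

lemma card_N: "card N = d"
  using reg v by (auto simp: regular_graph_def vdegree_def)

lemma finite_N: "finite N"
  by (rule simple_graph_neighbors[OF H])

lemma finite_outer: "finite outer"
  using H by (auto simp: outer_def simple_graph_def)

lemma card_verts: "card (verts H) = card outer + d + 1"
proof -
  have "verts H = outer \<union> insert v N"
    using v simple_graph_neighbors[OF H, of v] by (auto simp: outer_def)
  moreover have "outer \<inter> insert v N = {}" by (auto simp: outer_def)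
  ultimately show ?thesis
    using card_Un_disjoint[of outer "insert v N"] simple_graph_neighbors[OF H, of v]
      finite_outer card_N by simp
qed

lemma slotsD:
  assumes "i \<in> slots"
  shows "fst i \<subseteq> {..<2 * d - 1}" "card (fst i) = d" "finite (fst i)"
  using assms finite_subset[OF _ finite_lessThan] by (auto simp: slots_def)

lemma labelling: "i \<in> slots \<Longrightarrow> bij_betw (labelling (fst i)) N (fst i)"
  unfolding labelling_def
  by (rule someI_ex[OF finite_same_card_bij]) (auto simp: finite_N card_N slotsD)

lemma place_outer: "y \<in> outer \<Longrightarrow> place i y = Inr (i, y)"
  by (simp add: place_def outer_def)

lemma place_N: "x \<in> N \<Longrightarrow> place i x = Inl (labelling (fst i) x)"
  by (simp add: place_def)

lemma place_inj:
  assumes "i \<in> slots"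
  shows "inj_on (place i) (verts H - {v})"
  using labelling[OF assms] by (auto simp: place_def inj_on_def bij_betw_def)

lemma place_in_host:
  assumes "i \<in> slots" "x \<in> verts H - {v}"
  shows "place i x \<in> verts host"
  using assms labelling[OF assms(1)] slotsD[OF assms(1)]
  by (auto simp: place_def host_def outer_def bij_betw_def)

lemma place_edge_in_host:
  "i \<in> slots \<Longrightarrow> e \<in> edges H \<Longrightarrow> v \<notin> e \<Longrightarrow> place i ` e \<in> edges host"
  unfolding host_def sgraph.simps by blast

lemma simple_host: "simple_graph host"
  unfolding simple_graph_def
proof (intro conjI subsetI)
  have "slots \<subseteq> Pow {..<2 * d - 1} \<times> UNIV" by (auto simp: slots_def)
  then have "finite slots" by (rule finite_subset) auto
  then show "finite (verts host)" using finite_outer by (auto simp: host_def)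
  fix e assume "e \<in> edges host"
  then obtain i e' where e: "e = place i ` e'" "i \<in> slots" "e' \<in> edges H" "v \<notin> e'"
    by (auto simp: host_def)
  obtain x y where xy: "e' = {x, y}" "x \<in> verts H" "y \<in> verts H" "x \<noteq> y"
    using H e(3) by (rule simple_graph_edgeE)
  have "place i x \<noteq> place i y"
    using place_inj[OF e(2)] xy e(4) by (auto dest: inj_onD)
  moreover have "place i x \<in> verts host" "place i y \<in> verts host"
    using place_in_host[OF e(2)] xy e(4) by auto
  ultimately show "e \<in> {{u, v} |u v. u \<in> verts host \<and> v \<in> verts host \<and> u \<noteq> v}"
    using e xy by auto
qed

text \<open>The ends cannot both lie in the independent set \<open>N(v)\<close>. Consequently the
  shared points are independent in the host, and every host edge has a private end that determines
  its color.\<close>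

lemma edge_meets_outer:
  assumes "e \<in> edges H" "v \<notin> e"
  shows "\<exists>y\<in>e. y \<in> outer"
proof -
  obtain x y where xy: "e = {x, y}" "x \<in> verts H" "y \<in> verts H"
    using H assms(1) by (rule simple_graph_edgeE)
  then show ?thesis
    using indep assms by (auto simp: independent_set_def outer_def)
qed

lemma host_coloring_place:
  assumes "e \<in> edges H" "v \<notin> e"
  shows "host_coloring (place i ` e) = snd i"
proof -
  obtain y where "y \<in> e" "y \<in> outer" using edge_meets_outer[OF assms] by blast
  then have "Inr (i, y) \<in> place i ` e" using place_outer by (metis imageI)
  moreover have "j = i" if "Inr (j, z) \<in> place i ` e" for j z
    using that by (auto simp: place_def split: if_splits)
  ultimately show ?thesis
    unfolding host_coloring_def by (metis (full_types) prod.collapse snd_conv)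
qed

text \<open>The tag \<open>i\<close> leaves only one slot that can have produced the edge. Hence a
  private vertex has no host neighbors beyond the images of the neighbors of
  \<open>y\<close>.\<close>

lemma host_edge_at_outer:
  assumes "{u, Inr (i, y)} \<in> edges host"
  shows "i \<in> slots" "y \<in> outer" "u \<in> place i ` neighbors H y"
    "host_coloring {u, Inr (i, y)} = snd i"
proof -
  obtain j e where e: "{u, Inr (i, y)} = place j ` e" "j \<in> slots" "e \<in> edges H" "v \<notin> e"
    using assms by (auto simp: host_def)
  then have "Inr (i, y) \<in> place j ` e" by auto
  then have ij: "j = i" "y \<in> e" "y \<notin> N"
    by (auto simp: place_def split: if_splits)
  obtain x z where "e = {x, z}" "x \<in> verts H" "z \<in> verts H" "x \<noteq> z"
    using H e(3) by (rule simple_graph_edgeE)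
  with ij obtain x' where x': "e = {x', y}" "x' \<noteq> y" "x' \<in> verts H" "y \<in> verts H" by auto
  show i: "i \<in> slots" and y: "y \<in> outer"
    using e ij x' by (auto simp: outer_def)
  show "host_coloring {u, Inr (i, y)} = snd i"
    using e ij host_coloring_place by simp
  have "place i x' \<noteq> place i y"
    using place_inj[OF i] x' e(4) by (auto dest: inj_onD)
  then have "u = place i x'"
    using e(1) x' ij place_outer[OF y] by (auto simp: doubleton_eq_iff)
  then show "u \<in> place i ` neighbors H y"
    using x' e(3) by (auto simp: neighbors_def)
qed

lemma host_edge_at_Inl:
  assumes "{u, Inl k} \<in> edges host"
  shows "\<exists>i y. u = Inr (i, y) \<and> k \<in> fst i"
proof -
  obtain j e where e: "{u, Inl k} = place j ` e" "j \<in> slots" "e \<in> edges H" "v \<notin> e"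
    using assms by (auto simp: host_def)
  obtain y where "y \<in> e" "y \<in> outer" using edge_meets_outer[OF e(3,4)] by blast
  then have "Inr (j, y) \<in> {u, Inl k}" using e(1) place_outer by (metis imageI)
  then have "u = Inr (j, y)" by auto
  moreover have "k \<in> fst j"
  proof -
    have "Inl k \<in> place j ` e" using e(1) by auto
    then show ?thesis
      using labelling[OF e(2)] by (auto simp: place_def bij_betw_def split: if_splits)
  qed
  ultimately show ?thesis by blast
qed

text \<open>Having degree at least 2, \<open>x\<close> has a neighbor other than \<open>v\<close>,
  and independence keeps that neighbor out of \<open>N(v)\<close>. For \<open>d = 1\<close> this
  fails, as \<open>v\<close> is then the only neighbor of \<open>x\<close>.\<close>

lemma N_has_outer_neighbor:
  assumes "d \<ge> 2" "x \<in> N"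
  shows "\<exists>y\<in>outer. x \<in> neighbors H y"
proof -
  have x: "x \<in> verts H" using assms(2) simple_graph_neighbors[OF H] by blast
  then have "card (neighbors H x) = d"
    using reg by (auto simp: regular_graph_def vdegree_def)
  then have "\<not> neighbors H x \<subseteq> {v}"
    using assms(1) card_mono[of "{v}" "neighbors H x"] by auto
  then obtain y where y: "{y, x} \<in> edges H" "y \<noteq> v" by (auto simp: neighbors_def)
  then have "y \<notin> N"
    using indep assms(2) by (auto simp: independent_set_def)
  with y simple_graph_edgeD[OF H y(1)] show ?thesis
    by (auto simp: outer_def neighbors_def insert_commute)
qed

section \<open>Refuting a monochromatic copy in the host\<close>

context
  fixes b g
  assumes g: "mono_embedding host_coloring b g H host"
begin

lemma regular_neighbors: "x \<in> verts H \<Longrightarrow> card (g ` neighbors H x) = d"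
  using mono_embedding_neighbors(2)[OF g H] reg by (auto simp: regular_graph_def)

lemma ex_neighbor:
  assumes "x \<in> verts H"
  obtains x' where "x' \<in> verts H" "{g x', g x} \<in> edges host" "host_coloring {g x', g x} = b"
proof -
  have "g ` neighbors H x \<noteq> {}" using regular_neighbors[OF assms] d by auto
  then obtain x' where x': "x' \<in> neighbors H x" by auto
  then have "g x' \<in> {u \<in> neighbors host (g x). host_coloring {u, g x} = b}"
    using mono_embedding_neighbors(1)[OF g H assms] by auto
  then show ?thesis
    using that[of x'] x' simple_graph_neighbors[OF H, of x] by (auto simp: neighbors_def)
qed

text \<open>As \<open>d\<close> is positive, the vertex lies on an edge of the copy. That edge has
  color \<open>b\<close>, but also the color of the slot, like every host edge at a private
  vertex.\<close>

lemma image_slot: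
  assumes "Inr (i, y) \<in> g ` verts H"
  shows "i \<in> slots" "y \<in> outer" "snd i = b"
proof -
  obtain x where x: "x \<in> verts H" "g x = Inr (i, y)" using assms by force
  obtain x' where "{g x', Inr (i, y)} \<in> edges host" "host_coloring {g x', Inr (i, y)} = b"
    using ex_neighbor[OF x(1)] x(2) by metis
  then show "i \<in> slots" "y \<in> outer" "snd i = b"
    using host_edge_at_outer by auto
qed

text \<open>A copy of a vertex outside \<open>N(v)\<close> has degree exactly \<open>d\<close> in the host, so an embedding that
  uses it must use all its neighbors.\<close>

lemma image_closed:
  assumes "Inr (i, y) \<in> g ` verts H"
  shows "place i ` neighbors H y \<subseteq> g ` verts H"
proof -
  obtain x where x: "x \<in> verts H" "g x = Inr (i, y)" using assms by force
  note slot = image_slot[OF assms]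
  have "g ` neighbors H x \<subseteq> place i ` neighbors H y"
  proof
    fix u assume "u \<in> g ` neighbors H x"
    then have "{u, Inr (i, y)} \<in> edges host"
      using mono_embedding_neighbors(1)[OF g H x(1)] x(2) by (auto simp: neighbors_def)
    then show "u \<in> place i ` neighbors H y" by (rule host_edge_at_outer)
  qed
  moreover have "card (place i ` neighbors H y) \<le> d"
    using card_image_le[OF simple_graph_neighbors(2)[OF H, of y], of "place i"] reg slot(2)
    by (auto simp: regular_graph_def vdegree_def outer_def)
  ultimately have "g ` neighbors H x = place i ` neighbors H y"
    using regular_neighbors[OF x(1)] simple_graph_neighbors(2)[OF H, of y]
    by (intro card_seteq) auto
  then show ?thesis using simple_graph_neighbors(1)[OF H, of x] by blast
qed

text \<open>\<open>image_closed\<close> carries membership along edges, so connectedness of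
  \<open>H - v - N(v)\<close> spreads it from \<open>y\<close> over the whole private part.\<close>

lemma image_contains_copy:
  assumes "Inr (i, y) \<in> g ` verts H" "z \<in> outer"
  shows "Inr (i, z) \<in> g ` verts H"
proof -
  let ?D = "delete_verts H ({v} \<union> N)"
  have D: "verts ?D = outer" by (simp add: delete_verts_simps outer_def)
  have "(y, z) \<in> {(x, y). {x, y} \<in> edges ?D}\<^sup>*"
    using conn image_slot(2)[OF assms(1)] assms(2) unfolding connected_graph_def D by blast
  then show ?thesis
  proof (induction rule: rtrancl_induct)
    case base
    show ?case by (rule assms(1))
  next
    case (step x z)
    then have e: "{x, z} \<in> edges H" "z \<in> outer" by (auto simp: delete_verts_simps outer_def)
    then have "z \<in> neighbors H x" by (simp add: neighbors_def insert_commute)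
    then have "place i z \<in> g ` verts H" using image_closed[OF step.IH] by blast
    then show ?case by (simp add: place_outer e)
  qed
qed

text \<open>Each attachment point is adjacent to some private vertex of slot \<open>i\<close>; all
  of these are in the image, which is closed under their neighbors.\<close>

lemma image_contains_attachment:
  assumes "Inr (i, y) \<in> g ` verts H" "d \<ge> 2"
  shows "Inl ` fst i \<subseteq> g ` verts H"
proof
  fix u :: "nat + (nat set \<times> bool) \<times> 'a" assume "u \<in> Inl ` fst i"
  then obtain x where x: "x \<in> N" "u = place i x"
    using labelling[OF image_slot(1)[OF assms(1)]] by (auto simp: bij_betw_def place_N)
  obtain z where "z \<in> outer" "x \<in> neighbors H z"
    using N_has_outer_neighbor[OF assms(2) x(1)] by blast
  then show "u \<in> g ` verts H"
    using image_closed[OF image_contains_copy[OF assms(1)]] x(2) by blast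
qed

lemma card_image: "card (g ` verts H) = card outer + d + 1"
  using g card_verts by (simp add: mono_embedding_def card_image)

lemma finite_image: "finite (g ` verts H)"
  using H by (simp add: simple_graph_def)

lemma image_slot_unique:
  assumes i: "Inr (i, y) \<in> g ` verts H" and j: "Inr (j, z) \<in> g ` verts H"
  shows "i = j"
proof (rule ccontr)
  assume "i \<noteq> j"
  note si = image_slot[OF i] and sj = image_slot[OF j]
  note Si = slotsD[OF si(1)] and Sj = slotsD[OF sj(1)]
  \<comment> \<open>Both slots have color \<open>b\<close>, so they can differ only in their
    sets.\<close>
  have ne: "fst i \<noteq> fst j" using \<open>i \<noteq> j\<close> si(3) sj(3) by (simp add: prod_eq_iff)
  \<comment> \<open>For \<open>d = 1\<close> there is a single attachment point, so the two sets
    would coincide.\<close>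
  have d2: "d \<ge> 2"
  proof (rule ccontr)
    assume "\<not> d \<ge> 2"
    then have "d = 1" using d by simp
    then have "fst i = {..<1}" "fst j = {..<1}"
      using card_subset_eq[OF finite_lessThan Si(1)] card_subset_eq[OF finite_lessThan Sj(1)] Si Sj
      by simp_all
    with ne show False by simp
  qed
  have union: "card (fst i \<union> fst j) \<ge> d + 1"
  proof -
    have "fst i \<subset> fst i \<union> fst j"
      using ne Si Sj by (metis Un_upper1 Un_upper2 card_subset_eq psubsetI)
    then have "card (fst i) < card (fst i \<union> fst j)"
      using Si Sj by (intro psubset_card_mono) auto
    then show ?thesis using Si by simp
  qed
  let ?U = "Inl ` (fst i \<union> fst j) :: (nat + (nat set \<times> bool) \<times> 'a) set"
    and ?V = "Inr ` ({i, j} \<times> outer) :: (nat + (nat set \<times> bool) \<times> 'a) set"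
  have "?U \<union> ?V \<subseteq> g ` verts H"
    using image_contains_attachment[OF i d2] image_contains_attachment[OF j d2]
      image_contains_copy[OF i] image_contains_copy[OF j] by auto
  then have "card (?U \<union> ?V) \<le> card outer + d + 1"
    using card_mono[OF finite_image] card_image by metis
  moreover have "card (?U \<union> ?V) = card ?U + card ?V"
    using Si Sj finite_outer by (intro card_Un_disjoint) auto
  moreover have "card ?U = card (fst i \<union> fst j)" "card ?V = 2 * card outer"
    using \<open>i \<noteq> j\<close> by (simp_all add: Finite_Set.card_image card_cartesian_product)
  \<comment> \<open>Two parts with their attachment sets have at least
    \<open>2 * card outer + d + 1\<close> vertices, which exceeds the size of \<open>H\<close>
    exactly because \<open>outer\<close> is nonempty.\<close>
  moreover have "card outer > 0" using si(2) finite_outer by (auto simp: card_gt_0_iff)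
  ultimately show False using union by linarith
qed

lemma no_mono_embedding: False
proof -
  \<comment> \<open>The shared points are independent, so \<open>g v\<close> or a neighbor of it in
    the copy is private.\<close>
  have "\<exists>i y. Inr (i, y) \<in> g ` verts H"
  proof (cases "g v")
    case (Inl k)
    then obtain x' where "x' \<in> verts H" "{g x', Inl k} \<in> edges host"
      using ex_neighbor[OF v] by metis
    then show ?thesis using host_edge_at_Inl by (metis imageI)
  next
    case (Inr p)
    then show ?thesis using v by (metis imageI prod.collapse)
  qed
  then obtain i y where i: "Inr (i, y) \<in> g ` verts H" by blast
  \<comment> \<open>\<open>?W\<close> is one private part with its attachment set. It has
    \<open>card outer + d\<close> vertices, one fewer than \<open>H\<close>: nothing in it plays the
    role of \<open>v\<close>.\<close>
  let ?W = "Inl ` fst i \<union> Inr ` ({i} \<times> outer)"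
  have "g x \<in> ?W" if x: "x \<in> verts H" for x
  proof (cases "g x")
    case (Inl k)
    then obtain x' where x': "x' \<in> verts H" "{g x', Inl k} \<in> edges host"
      using ex_neighbor[OF x] by metis
    then obtain j z where "g x' = Inr (j, z)" "k \<in> fst j" using host_edge_at_Inl by blast
    moreover from this have "j = i" using image_slot_unique[OF _ i] x'(1) by (metis imageI)
    ultimately show ?thesis using Inl by auto
  next
    case (Inr p)
    then have p: "Inr (fst p, snd p) \<in> g ` verts H" using x by (metis imageI prod.collapse)
    have "fst p = i" "snd p \<in> outer" using image_slot_unique[OF p i] image_slot[OF p] by auto
    then show ?thesis using Inr by (metis UnI2 imageI mem_Sigma_iff prod.collapse singletonI)
  qed
  then have "g ` verts H \<subseteq> ?W" by blast
  moreover have fin: "finite (fst i)" using slotsD image_slot(1)[OF i] by blast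
  ultimately have "card outer + d + 1 \<le> card ?W"
    using card_mono[of ?W "g ` verts H"] card_image finite_outer by simp
  also have "\<dots> = card (fst i) + card outer"
    using fin finite_outer
    by (subst card_Un_disjoint) (auto simp: Finite_Set.card_image card_cartesian_product)
  also have "\<dots> = d + card outer" using slotsD image_slot(1)[OF i] by simp
  finally show False by simp
qed

end

lemma host_no_mono_copy: "\<not> has_mono_copy host_coloring host H"
  using has_mono_copy_iff[OF simple_host H] no_mono_embedding by blast

section \<open>Attaching a new vertex to a gadget\<close>

lemma ex_arrowing_graph_with_critical_vertex:
  assumes "has_BEL_gadgets H"
  shows "\<exists>(F :: nat sgraph) w. simple_graph F \<and> arrows F H \<and> \<not> arrows (delete_verts F {w}) H \<and>
    vdegree F w \<le> 2 * d - 1"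
proof -
  \<comment> \<open>Gadgets are available only for graphs on \<open>nat\<close>, so the finite host
    is first transported there by an injection \<open>f\<close>.\<close>
  have "finite (verts host)" using simple_host by (simp add: simple_graph_def)
  then obtain f :: "nat + (nat set \<times> bool) \<times> 'a \<Rightarrow> nat" where f: "inj_on f (verts host)"
    using finite_imp_inj_to_nat_seg by blast
  let ?G = "map_sgraph f host"
  define \<psi> where "\<psi> e = host_coloring (inv_into (verts host) f ` e)" for e
  have \<psi>: "\<psi> (f ` e) = host_coloring e" if "e \<in> edges host" for e
    using inv_into_image_cancel[OF f simple_graph_edge_subset[OF simple_host that]]
    by (simp add: \<psi>_def)
  have G: "simple_graph ?G" by (rule simple_graph_map[OF simple_host f])
  have "\<not> has_mono_copy \<psi> ?G H"
    using has_mono_copy_map[where c = \<psi>, OF simple_host H f \<psi>] host_no_mono_copy by blast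
  with G assms obtain F where F: "simple_graph F" "\<not> arrows F H" "induced_subgraph ?G F"
    and rigid: "\<And>c. \<not> has_mono_copy c F H \<Longrightarrow>
      (\<forall>e \<in> edges ?G. c e = \<psi> e) \<or> (\<forall>e \<in> edges ?G. c e = (\<not> \<psi> e))"
    unfolding has_BEL_gadgets_def by blast
  have GF: "f ` verts host \<subseteq> verts F" "\<And>e. e \<in> edges host \<Longrightarrow> f ` e \<in> edges F"
    using F(3) by (auto simp: induced_subgraph_def subgraph_def map_sgraph_def)
  obtain w where w: "w \<notin> verts F"
    using F(1) by (metis ex_new_if_finite infinite_UNIV_nat simple_graph_def)
  let ?a = "\<lambda>k. f (Inl k)"
  have a: "?a k \<in> verts F" "?a k \<noteq> w" if "k < 2 * d - 1" for k
    using GF(1) w that by (auto simp: host_def)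
  define F' where "F' = \<lparr>verts = insert w (verts F),
    edges = edges F \<union> {{?a k, w} | k. k < 2 * d - 1}\<rparr>"
  have F': "simple_graph F'"
    using F(1) a unfolding simple_graph_def F'_def by fastforce
  have wF: "w \<notin> e" if "e \<in> edges F" for e
    using simple_graph_edge_subset[OF F(1) that] w by blast
  have sub: "subgraph F F'" using F(1) F' by (auto simp: subgraph_def F'_def)
  have "delete_verts F' {w} = F"
  proof (rule sgraph.equality)
    show "verts (delete_verts F' {w}) = verts F"
      using w by (auto simp: delete_verts_simps F'_def)
    show "edges (delete_verts F' {w}) = edges F"
      using wF simple_graph_edge_subset[OF F(1)] by (auto simp: delete_verts_simps F'_def)
  qed simp
  moreover have "vdegree F' w \<le> 2 * d - 1"
  proof -
    have "neighbors F' w \<subseteq> ?a ` {..<2 * d - 1}"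
      using wF a by (auto simp: neighbors_def F'_def doubleton_eq_iff)
    then have "vdegree F' w \<le> card (?a ` {..<2 * d - 1})"
      unfolding vdegree_def by (intro card_mono) auto
    also have "\<dots> \<le> 2 * d - 1" using card_image_le[of "{..<2 * d - 1}" ?a] by simp
    finally show ?thesis .
  qed
  moreover have "arrows F' H"
    unfolding arrows_def
  proof
    fix c
    show "has_mono_copy c F' H"
    proof (cases "has_mono_copy c F H")
      case True
      then show ?thesis using sub subgraph_trans unfolding has_mono_copy_def by blast
    next
      case False
      \<comment> \<open>\<open>s\<close> records whether \<open>c\<close> follows the prescribed
        coloring or its swap.\<close>
      obtain s where s: "\<And>e. e \<in> edges ?G \<Longrightarrow> c e = (\<psi> e = s)"
        using rigid[OF False] by (metis (full_types))
      let ?T = "\<lambda>b. {k \<in> {..<2 * d - 1}. c {?a k, w} = b}"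
      have "card (?T True \<union> ?T False) = card (?T True) + card (?T False)"
        by (rule card_Un_disjoint) auto
      moreover have "?T True \<union> ?T False = {..<2 * d - 1}" by auto
      ultimately have "card (?T True) + card (?T False) = 2 * d - 1" by simp
      then have "card (?T True) \<ge> d \<or> card (?T False) \<ge> d" by linarith
      then have "\<exists>b. card (?T b) \<ge> d" by (rule disjE) (rule exI, assumption)+
      then obtain b where "card (?T b) \<ge> d" by (rule exE)
      then obtain S where S: "S \<subseteq> ?T b" "card S = d"
        by (rule obtain_subset_with_card_n)
      \<comment> \<open>The slot color is \<open>b = s\<close> because \<open>c\<close> turns it
        into \<open>(b = s) = s\<close>, that is, into \<open>b\<close>.\<close>
      define i where "i = (S, b = s)"
      have i: "i \<in> slots" using S by (auto simp: slots_def i_def)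
      \<comment> \<open>The new vertex takes the role of \<open>v\<close>: its edges to
        \<open>S\<close> have color \<open>b\<close> by the choice of \<open>S\<close>, and the rest
        of \<open>H\<close> is supplied by slot \<open>i\<close>.\<close>
      define g where "g x = (if x = v then w else f (place i x))" for x
      have inj': "inj_on (f \<circ> place i) (verts H - {v})"
        using place_inj[OF i] place_in_host[OF i] f
        by (intro comp_inj_on) (auto intro: inj_on_subset)
      have im': "f (place i x) \<in> verts F" if "x \<in> verts H - {v}" for x
        using place_in_host[OF i that] GF(1) by blast
      then have im: "g ` verts H \<subseteq> verts F'" by (auto simp: g_def F'_def)
      have inj: "inj_on g (verts H)"
      proof (rule inj_onI)
        fix x y assume "x \<in> verts H" "y \<in> verts H" "g x = g y"
        then show "x = y"
          using inj_onD[OF inj', of x y] im'[of x] im'[of y] w by (auto simp: g_def split: if_splits)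
      qed
      have "g ` e \<in> edges F' \<and> c (g ` e) = b" if e: "e \<in> edges H" for e
      proof (cases "v \<in> e")
        case True
        obtain x y where "e = {x, y}" "x \<noteq> y"
          using H e by (rule simple_graph_edgeE)
        with True obtain x where x: "e = {x, v}" "x \<noteq> v" by auto
        then have xN: "x \<in> N" using e by (simp add: neighbors_def)
        then have "labelling S x \<in> S"
          using labelling[OF i] by (auto simp: i_def bij_betw_def)
        moreover have "g ` e = {?a (labelling S x), w}"
          using x xN by (simp add: g_def place_N i_def)
        ultimately show ?thesis using S(1) by (auto simp: F'_def)
      next
        case False
        then have "g ` e = f ` place i ` e" by (auto simp: g_def image_iff)
        moreover have "place i ` e \<in> edges host" by (rule place_edge_in_host[OF i e False])
        moreover have "host_coloring (place i ` e) = (b = s)"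
          using host_coloring_place[OF e False, of i] by (simp add: i_def)
        ultimately show ?thesis
          using s[of "g ` e"] \<psi> GF(2) by (auto simp: F'_def map_sgraph_def)
      qed
      with inj im have "mono_embedding c b g H F'" by (simp add: mono_embedding_def)
      then show ?thesis using has_mono_copy_iff[OF F' H] by blast
    qed
  qed
  ultimately show ?thesis using F' F(2) by metis
qed

end

section \<open>Combining the two bounds\<close>

theorem theorem4p2:
  fixes H :: "'a sgraph" and d :: nat
  assumes "d \<ge> 1"
    and "simple_graph H"
    and "regular_graph d H"
    and "has_BEL_gadgets H"
    and "\<exists>v \<in> verts H. independent_set H (neighbors H v) \<and>
           connected_graph (delete_verts H ({v} \<union> neighbors H v))"
  shows "ramsey_s H = 2 * d - 1"
proof -
  obtain v where v: "regular_pointed_graph H v d"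
    using assms by (auto simp: regular_pointed_graph_def)
  then have "v \<in> verts H" by (simp add: regular_pointed_graph_def)
  have fin: "finite (verts M)" if "M \<in> ramsey_minimal_graphs H" for M
    using that by (auto simp: ramsey_minimal_graphs_def simple_graph_def)
  have lower: "2 * d - 1 \<le> min_degree M" if M: "M \<in> ramsey_minimal_graphs H" for M
  proof -
    have "simple_graph M" "arrows M H" using M by (auto simp: ramsey_minimal_graphs_def)
    \<comment> \<open>\<open>Min\<close> is meaningful only on a nonempty set; a copy of
      \<open>H\<close> in \<open>M\<close> provides a vertex.\<close>
    then obtain b c g where "mono_embedding c b g H M"
      using has_mono_copy_iff[OF _ assms(2)] unfolding arrows_def by blast
    then have "verts M \<noteq> {}" using \<open>v \<in> verts H\<close> by (auto simp: mono_embedding_def)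
    then show ?thesis
      using fin[OF M] ramsey_minimal_vdegree_ge[OF assms(2,3) M] by (simp add: min_degree_def)
  qed
  obtain F :: "nat sgraph" and w where F: "simple_graph F" "arrows F H"
    "\<not> arrows (delete_verts F {w}) H" "vdegree F w \<le> 2 * d - 1"
    using regular_pointed_graph.ex_arrowing_graph_with_critical_vertex[OF v assms(4)] by blast
  obtain M where M: "subgraph M F" "M \<in> ramsey_minimal_graphs H"
    using ex_ramsey_minimal_subgraph[OF F(1,2)] by blast
  \<comment> \<open>Otherwise \<open>M\<close> would lie in \<open>F - w\<close> and make it arrow
    \<open>H\<close>.\<close>
  have w: "w \<in> verts M"
  proof (rule ccontr)
    assume "w \<notin> verts M"
    then have "subgraph M (delete_verts F {w})"
      using M(1) subgraph_delete_verts[OF F(1), of "{w}"] simple_graph_edge_subset[of M]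
      by (auto simp: subgraph_def delete_verts_simps)
    then show False
      using M(2) F(3) arrows_subgraph by (auto simp: ramsey_minimal_graphs_def)
  qed
  then have "min_degree M \<le> vdegree M w"
    using fin[OF M(2)] by (simp add: min_degree_def)
  also have "\<dots> \<le> vdegree F w"
    unfolding vdegree_def using M(1) simple_graph_neighbors(2)[OF F(1)]
    by (intro card_mono) (auto simp: neighbors_def subgraph_def)
  finally have "min_degree M = 2 * d - 1" using lower[OF M(2)] F(4) by linarith
  then have "2 * d - 1 \<in> min_degree ` ramsey_minimal_graphs H"
    using M(2) by force
  then show ?thesis
    unfolding ramsey_s_def using lower by (intro cInf_eq_minimum) auto
qed

end
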